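(* Let $N\ge 1$, let $f_1,\dots,f_N:\mathbb{R}\to\mathbb{R}$ be convex functions, let $X_1,\dots,X_N\subseteq\mathbb{R}$ be closed convex sets such that $\mathrm{int}\,X=\bigcap_{i=1}^N\mathrm{int}\,X_i$ is nonempty, where $X=\bigcap_{i=1}^N X_i$, and assume that $f^*=\min_{x\in X}\sum_{i=1}^N f_i(x)$ is finite and attained. Let $\mathcal{G}$ be a connected weighted undirected graph on $\{1,\dots,N\}$ with Laplacian $L$. Let the step sizes $\alpha_k>0$ satisfy $$\sum_{k=1}^\infty\alpha_k=\infty,\qquad \sum_{k=1}^\infty\alpha_k^2<\infty,$$ and let $\varepsilon_k=\varepsilon_0$ for all $k\ge 1$, for some fixed scalar $\varepsilon_0>0$. Let $\{(\mathbf{x}(k),\mathbf{v}(k))\}_{k\ge1}$ be a sequence generated by the projected primal-dual $\varepsilon$-subgradient algorithm $$x_i(k+1)=P_{X_i}\big[x_i(k)-\alpha_k\big(g_i(k)+\hat x_i(k)+\hat v_i(k)\big)\big],\qquad v_i(k+1)=v_i(k)+\alpha_k\hat x_i(k),\qquad i=1,\dots,N,$$ with $g_i(k)\in\partial_{\varepsilon_k}f_i(x_i(k))$, and suppose there is $C>0$ such that $\max_{1\le i\le N}|g_i(k)|<C$ for all $k\ge1$. Let $(\mathbf{x}^*,\mathbf{v}^* )$ be a saddle point of $\Phi$ in $\tilde X\times\mathbb{R}^N$, and let $\bar\Delta=\liminf_{k\to\infty}\Delta(\mathbf{x}(k))$. Then $$0\le\bar\Delta\le N\varepsilon_0 .$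$
   Context: Graph: $\mathcal{G}$ has symmetric weights $a_{ij}=a_{ji}\ge0$, $a_{ii}=0$, with $a_{ij}>0$ iff there is an edge between $i$ and $j$. Its Laplacian $L=[l_{ij}]\in\mathbb{R}^{N\times N}$ is $l_{ii}=\sum_{j\ne i}a_{ij}$, $l_{ij}=-a_{ij}$ for $j\neq i$. $\varepsilon$-subgradient: for a convex $f:\mathbb{R}^m\to\mathbb{R}$ and $\varepsilon>0$, a vector $g$ is an $\varepsilon$-subgradient of $f$ at $x$ if $f(y)\ge f(x)+g^\top(y-x)-\varepsilon$ for all $y\in\mathbb{R}^m$; $\partial_\varepsilon f(x)$ is the set of all $\varepsilon$-subgradients of $f$ at $x$. $P_{X_i}$ is the Euclidean projection onto the closed convex set $X_i$. Notation: $\mathbf{x}=(x_1,\dots,x_N)^\top$, $\mathbf{v}=(v_1,\dots,v_N)^\top\in\mathbb{R}^N$, $\tilde X=X_1\times\cdots\times X_N$, $\tilde f(\mathbf{x})=\sum_{i=1}^N f_i(x_i)$, $\hat x_i(k)=\sum_{j=1}^N a_{ij}(x_i(k)-x_j(k))$, $\hat v_i(k)=\sum_{j=1}^N a_{ij}(v_i(k)-v_j(k))$. The initial values $\mathbf{x}(1),\mathbf{v}(1)$ are given. Augmented Lagrangian: $\Phi(\mathbf{x},\mathbf{v})=\tilde f(\mathbf{x})+\mathbf{v}^\top L\mathbf{x}+\tfrac12\mathbf{x}^\top L\mathbf{x}$. A pair $(\mathbf{x}^*,\mathbf{v}^* )\in\tilde X\times\mathbb{R}^N$ is a saddle point of $\Phi$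 in $\tilde X\times\mathbb{R}^N$ if $\Phi(\mathbf{x}^*,\mathbf{v})\le\Phi(\mathbf{x}^*,\mathbf{v}^* )\le\Phi(\mathbf{x},\mathbf{v}^* )$ for all $\mathbf{x}\in\tilde X$, $\mathbf{v}\in\mathbb{R}^N$. For the fixed saddle point, $\Delta(\mathbf{x})=\Phi(\mathbf{x},\mathbf{v}^* )-\Phi(\mathbf{x}^*,\mathbf{v}^* )+\tfrac12\mathbf{x}^\top L\mathbf{x}$. *)

theory Defs
  imports "HOL-Analysis.Analysis"
begin

text \<open>
  Nodes are the elements of a finite index type \<open>'n\<close>, so the number of nodes is \<open>CARD('n)\<close>.
  A weighted undirected graph is given by its weight matrix; there is an edge between
  \<open>i\<close> and \<open>j\<close> iff \<open>a $ i $ j > 0\<close>.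
\<close>

definition weighted_graph :: "real ^ 'n ^ 'n::finite \<Rightarrow> bool" where
  "weighted_graph a \<longleftrightarrow>
     (\<forall>i j. a $ i $ j = a $ j $ i) \<and> (\<forall>i j. 0 \<le> a $ i $ j) \<and> (\<forall>i. a $ i $ i = 0)"

definition graph_edges :: "real ^ 'n ^ 'n::finite \<Rightarrow> ('n \<times> 'n) set" where
  "graph_edges a = {(i, j). 0 < a $ i $ j}"

definition graph_connected :: "real ^ 'n ^ 'n::finite \<Rightarrow> bool" where
  "graph_connected a \<longleftrightarrow> (\<forall>i j. (i, j) \<in> (graph_edges a)\<^sup>*)"

definition laplacian :: "real ^ 'n ^ 'n::finite \<Rightarrow> real ^ 'n ^ 'n" where
  "laplacian a = (\<chi> i j. if i = j then (\<Sum>l\<in>UNIV - {i}. a $ i $ l) else - (a $ i $ j))"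

definition eps_subdifferential ::
    "real \<Rightarrow> ('a::real_inner \<Rightarrow> real) \<Rightarrow> 'a \<Rightarrow> 'a set" where
  "eps_subdifferential \<epsilon> f x = {g. \<forall>y. f y \<ge> f x + g \<bullet> (y - x) - \<epsilon>}"

definition disagreement :: "real ^ 'n ^ 'n::finite \<Rightarrow> real ^ 'n \<Rightarrow> 'n \<Rightarrow> real" where
  "disagreement a x i = (\<Sum>j\<in>UNIV. a $ i $ j * (x $ i - x $ j))"

definition product_set :: "('n::finite \<Rightarrow> real set) \<Rightarrow> (real ^ 'n) set" where
  "product_set X = {x. \<forall>i. x $ i \<in> X i}"

definition aug_lagrangian ::
    "('n::finite \<Rightarrow> real \<Rightarrow> real) \<Rightarrow> real ^ 'n ^ 'n \<Rightarrow> real ^ 'n \<Rightarrow> real ^ 'n \<Rightarrow> real" where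
  "aug_lagrangian f L x v =
     (\<Sum>i\<in>UNIV. f i (x $ i)) + v \<bullet> (L *v x) + 1/2 * (x \<bullet> (L *v x))"

definition saddle_point ::
    "('a \<Rightarrow> 'b \<Rightarrow> real) \<Rightarrow> 'a set \<Rightarrow> 'b set \<Rightarrow> 'a \<Rightarrow> 'b \<Rightarrow> bool" where
  "saddle_point \<Phi> S T xs vs \<longleftrightarrow>
     xs \<in> S \<and> vs \<in> T \<and> (\<forall>x\<in>S. \<forall>v\<in>T. \<Phi> xs v \<le> \<Phi> xs vs \<and> \<Phi> xs vs \<le> \<Phi> x vs)"

definition saddle_gap ::
    "('n::finite \<Rightarrow> real \<Rightarrow> real) \<Rightarrow> real ^ 'n ^ 'n \<Rightarrow> real ^ 'n \<Rightarrow> real ^ 'n \<Rightarrow> real ^ 'n \<Rightarrow> real" where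
  "saddle_gap f L xs vs x =
     aug_lagrangian f L x vs - aug_lagrangian f L xs vs + 1/2 * (x \<bullet> (L *v x))"

end

theory Submission
  imports Defs
begin

text \<open>
  The Lyapunov function \<open>V k = (norm (x k - xs))\<^sup>2 + (norm (v k - vs))\<^sup>2\<close> satisfies
  \<open>V (k + 1) \<le> V k - 2 * \<alpha> k * (gap (x k) - N * \<epsilon>0) + c * (\<alpha> k)\<^sup>2 * (1 + V k)\<close>: projections are
  nonexpansive, \<open>L xs = 0\<close> because \<open>xs\<close> maximises an affine function of the multiplier, and
  symmetry of \<open>L\<close> cancels the terms in \<open>v k\<close>. If the gap stayed above \<open>N * \<epsilon>0\<close> by a
  fixed amount, square summability of the steps would bound \<open>V\<close>, and telescoping would make the
  steps themselves summable.
\<close>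

section \<open>Descent recursions with summable perturbations: a deterministic Robbins-Siegmund
  argument\<close>

lemma summable_of_perturbed_descent:
  fixes W b u :: "nat \<Rightarrow> real"
  assumes W: "\<And>k. 0 \<le> W k" and b: "\<And>k. 0 \<le> b k" and u: "\<And>k. 0 \<le> u k"
    and sb: "summable b"
    and step: "\<And>k. W (Suc k) \<le> (1 + b k) * W k - u k"
  shows "summable u"
proof -
  define B where "B = W 0 * exp (suminf b)"
  \<comment> \<open>Discrete Gronwall: each factor \<open>1 + b k\<close> is at most
    \<open>exp (b k)\<close>, so the product of factors becomes the exponential of a sum that
    \<open>suminf b\<close> bounds.\<close>
  have growth: "W k \<le> W 0 * exp (\<Sum>j<k. b j)" for k
  proof (induction k)
    case (Suc k)
    have "W (Suc k) \<le> (1 + b k) * W k"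
      using step[of k] u[of k] by linarith
    also have "\<dots> \<le> exp (b k) * (W 0 * exp (\<Sum>j<k. b j))"
      using Suc W[of k] b[of k] by (intro mult_mono) (auto simp: exp_ge_add_one_self)
    finally show ?case
      by (simp add: exp_add mult_ac)
  qed simp
  have WB: "W k \<le> B" for k
  proof -
    have "(\<Sum>j<k. b j) \<le> suminf b"
      by (rule sum_le_suminf) (use sb b in auto)
    then have "W 0 * exp (\<Sum>j<k. b j) \<le> B"
      unfolding B_def using W[of 0] by (intro mult_left_mono) auto
    then show ?thesis
      using growth[of k] by linarith
  qed
  have B0: "0 \<le> B"
    using W[of 0] WB[of 0] by linarith
  \<comment> \<open>Once \<open>W\<close> is bounded by \<open>B\<close>, the multiplicative
    perturbation \<open>b k * W k\<close> is an additive one of size at most \<open>B * b k\<close>,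
    and the recursion telescopes.\<close>
  have tele: "W n + (\<Sum>j<n. u j) \<le> W 0 + B * (\<Sum>j<n. b j)" for n
  proof (induction n)
    case (Suc n)
    have "b n * W n \<le> B * b n"
      using mult_left_mono[OF WB b, of n n] by (simp add: mult.commute)
    then show ?case
      using Suc step[of n] by (simp add: algebra_simps)
  qed simp
  show ?thesis
  proof (rule summableI_nonneg_bounded)
    fix n
    have "B * (\<Sum>j<n. b j) \<le> B * suminf b"
      by (intro mult_left_mono sum_le_suminf) (use sb b B0 in auto)
    then show "(\<Sum>j<n. u j) \<le> W 0 + B * suminf b"
      using tele[of n] W[of n] by linarith
  qed (rule u)
qed

section \<open>The Laplacian as a symmetric positive semidefinite form\<close>

lemma laplacian_mult_nth:
  fixes a :: "real ^ 'n ^ 'n::finite"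
  shows "(laplacian a *v x) $ i = disagreement a x i"
proof -
  have "(laplacian a *v x) $ i
      = (\<Sum>l\<in>UNIV - {i}. a $ i $ l) * x $ i - (\<Sum>j\<in>UNIV - {i}. a $ i $ j * x $ j)"
    by (simp add: matrix_vector_mult_def laplacian_def sum.remove[of UNIV i] sum_negf[symmetric])
  also have "\<dots> = (\<Sum>j\<in>UNIV - {i}. a $ i $ j * (x $ i - x $ j))"
    by (simp add: sum_distrib_right sum_subtractf right_diff_distrib)
  also have "\<dots> = disagreement a x i"
    by (simp add: disagreement_def sum.remove[of UNIV i])
  finally show ?thesis .
qed

lemma transpose_laplacian:
  assumes "weighted_graph a"
  shows "transpose (laplacian a) = laplacian a"
  using assms by (auto simp: vec_eq_iff transpose_def laplacian_def weighted_graph_def)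

lemma laplacian_inner_commute:
  assumes "weighted_graph a"
  shows "x \<bullet> (laplacian a *v y) = y \<bullet> (laplacian a *v x)"
  by (metis dot_lmul_matrix inner_commute transpose_laplacian[OF assms] transpose_matrix_vector)

text \<open>Swapping the summation indices and using the symmetry of the weights replaces the factor
  \<open>x $ i\<close> by \<open>- (x $ j)\<close>; averaging the two expressions produces the
  squares. Nonnegative weights then make the form nonnegative.\<close>

lemma laplacian_quadratic_form:
  fixes a :: "real ^ 'n ^ 'n::finite"
  assumes "weighted_graph a"
  shows "x \<bullet> (laplacian a *v x) = (\<Sum>i\<in>UNIV. \<Sum>j\<in>UNIV. a $ i $ j * (x $ i - x $ j)\<^sup>2) / 2"
proof -
  let ?q = "\<lambda>i j. a $ i $ j * (x $ i - x $ j)"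
  have e: "x \<bullet> (laplacian a *v x) = (\<Sum>i\<in>UNIV. \<Sum>j\<in>UNIV. x $ i * ?q i j)"
    by (simp add: inner_vec_def laplacian_mult_nth disagreement_def sum_distrib_left)
  also have "\<dots> = (\<Sum>i\<in>UNIV. \<Sum>j\<in>UNIV. x $ j * ?q j i)"
    by (rule sum.swap)
  also have "\<dots> = (\<Sum>i\<in>UNIV. \<Sum>j\<in>UNIV. - (x $ j * ?q i j))"
    using assms by (intro sum.cong refl) (simp add: weighted_graph_def algebra_simps)
  finally have "2 * (x \<bullet> (laplacian a *v x))
      = (\<Sum>i\<in>UNIV. \<Sum>j\<in>UNIV. x $ i * ?q i j) + (\<Sum>i\<in>UNIV. \<Sum>j\<in>UNIV. - (x $ j * ?q i j))"
    using e by linarith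
  also have "\<dots> = (\<Sum>i\<in>UNIV. \<Sum>j\<in>UNIV. a $ i $ j * (x $ i - x $ j)\<^sup>2)"
    by (simp add: sum.distrib[symmetric] power2_eq_square algebra_simps)
  finally show ?thesis by simp
qed

lemma laplacian_quadratic_form_nonneg:
  assumes "weighted_graph a"
  shows "0 \<le> x \<bullet> (laplacian a *v x)"
  unfolding laplacian_quadratic_form[OF assms]
  using assms by (auto intro!: sum_nonneg simp: weighted_graph_def)

section \<open>Saddle points and the gap function\<close>

lemma saddle_point_laplacian_eq_0:
  assumes "saddle_point (aug_lagrangian f L) S UNIV xs vs"
  shows "L *v xs = 0"
proof -
  \<comment> \<open>The Lagrangian is affine in the multiplier with slope \<open>L *v xs\<close>;
    moving from \<open>vs\<close> along this slope raises it by the squared norm of the slope, which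
    maximality of \<open>vs\<close> forces to be 0.\<close>
  have "aug_lagrangian f L xs (vs + L *v xs) \<le> aug_lagrangian f L xs vs"
    using assms unfolding saddle_point_def by blast
  then have "(L *v xs) \<bullet> (L *v xs) \<le> 0"
    by (simp add: aug_lagrangian_def inner_add_left)
  then show ?thesis
    by (metis inner_eq_zero_iff inner_ge_zero order_antisym)
qed

text \<open>The half quadratic form in the Lagrangian and the half added in the gap combine to the
  full \<open>y \<bullet> (L *v y)\<close>, which is what the primal step produces.\<close>

lemma saddle_gap_at_saddle_point:
  assumes "L *v xs = 0"
  shows "saddle_gap f L xs vs y
    = (\<Sum>i\<in>UNIV. f i (y $ i)) - (\<Sum>i\<in>UNIV. f i (xs $ i)) + vs \<bullet> (L *v y) + y \<bullet> (L *v y)"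
  using assms by (simp add: saddle_gap_def aug_lagrangian_def)

lemma saddle_gap_nonneg:
  assumes "weighted_graph a"
    and "saddle_point (aug_lagrangian f (laplacian a)) S UNIV xs vs" and "y \<in> S"
  shows "0 \<le> saddle_gap f (laplacian a) xs vs y"
proof -
  have "aug_lagrangian f (laplacian a) xs vs \<le> aug_lagrangian f (laplacian a) y vs"
    using assms(2,3) unfolding saddle_point_def by blast
  then show ?thesis
    using laplacian_quadratic_form_nonneg[OF assms(1), of y] by (simp add: saddle_gap_def)
qed

section \<open>Estimates for one iteration\<close>

lemma eps_subdifferential_sum:
  fixes x y g :: "real ^ 'n::finite"
  assumes "\<And>i. g $ i \<in> eps_subdifferential e (f i) (x $ i)"
  shows "(\<Sum>i\<in>UNIV. f i (x $ i)) - (\<Sum>i\<in>UNIV. f i (y $ i)) - real CARD('n) * e \<le> (x - y) \<bullet> g"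
proof -
  have "f i (x $ i) - f i (y $ i) - e \<le> (x $ i - y $ i) * g $ i" for i
    using assms[of i] unfolding eps_subdifferential_def
    by (auto simp: algebra_simps dest: spec[of _ "y $ i"])
  then have "(\<Sum>i\<in>UNIV. f i (x $ i) - f i (y $ i) - e) \<le> (\<Sum>i\<in>UNIV. (x $ i - y $ i) * g $ i)"
    by (intro sum_mono)
  then show ?thesis
    by (simp add: sum_subtractf inner_vec_def)
qed

text \<open>Projection onto a product acts coordinatewise: each \<open>closest_point\<close> is
  1-Lipschitz and fixes \<open>y $ i\<close>.\<close>

lemma norm_projection_diff_le:
  fixes w y z :: "real ^ 'n::finite"
  assumes "\<And>i. closed (X i)" and "\<And>i. convex (X i)" and "y \<in> product_set X"
    and "\<And>i. z $ i = closest_point (X i) (w $ i)"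
  shows "norm (z - y) \<le> norm (w - y)"
proof (rule norm_le_componentwise_cart)
  fix i
  have y: "y $ i \<in> X i"
    using assms(3) by (simp add: product_set_def)
  then have "X i \<noteq> {}"
    by auto
  from closest_point_lipschitz[OF assms(2,1) this, of "w $ i" "y $ i"]
  show "norm ((z - y) $ i) \<le> norm ((w - y) $ i)"
    using y by (simp add: assms(4) closest_point_self dist_norm)
qed

lemma power2_sum4_le:
  fixes p q r s :: real
  shows "(p + q + r + s)\<^sup>2 \<le> 4 * (p\<^sup>2 + q\<^sup>2 + r\<^sup>2 + s\<^sup>2)"
proof -
  \<comment> \<open>The six squares add up to exactly the right-hand side minus the left-hand
    side.\<close>
  have "0 \<le> (p - q)\<^sup>2 + (p - r)\<^sup>2 + (p - s)\<^sup>2 + (q - r)\<^sup>2 + (q - s)\<^sup>2 + (r - s)\<^sup>2"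
    by simp
  then show ?thesis
    by (simp add: power2_eq_square algebra_simps)
qed

text \<open>Since \<open>A *v xs = 0\<close>, the vector \<open>A *v x\<close> is controlled by
  \<open>x - xs\<close>, while \<open>A *v v\<close> is controlled by \<open>v - vs\<close> up to
  the fixed vector \<open>A *v vs\<close>. The constant \<open>c\<close> is the same for all
  \<open>g\<close>, \<open>x\<close>, \<open>v\<close>, hence for all iterations.\<close>

lemma increment_bound:
  fixes A :: "real ^ 'n ^ 'n::finite"
  assumes "A *v xs = 0"
  obtains c where "0 \<le> c" and
    "\<And>g x v. norm g \<le> G \<Longrightarrow> (norm (g + A *v x + A *v v))\<^sup>2 + (norm (A *v x))\<^sup>2
        \<le> c * (1 + ((norm (x - xs))\<^sup>2 + (norm (v - vs))\<^sup>2))"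
proof -
  obtain K where K: "\<And>y. norm (A *v y) \<le> norm y * K"
    using bounded_linear.bounded[OF matrix_vector_mul_bounded_linear] by blast
  have K2: "(norm (A *v y))\<^sup>2 \<le> (norm y)\<^sup>2 * K\<^sup>2" for y
    using power_mono[OF K norm_ge_zero, of y 2] by (simp add: power_mult_distrib)
  \<comment> \<open>The coefficient 5 is 4 from \<open>power2_sum4_le\<close> plus 1 from the
    separate term \<open>(norm (A *v x))\<^sup>2\<close>.\<close>
  define c where "c = 5 * K\<^sup>2 + 4 * G\<^sup>2 + 4 * (norm (A *v vs))\<^sup>2"
  show thesis
  proof (rule that)
    show "0 \<le> c"
      by (simp add: c_def)
    fix g x v :: "real ^ 'n"
    assume "norm g \<le> G"
    then have g: "(norm g)\<^sup>2 \<le> G\<^sup>2"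
      by (simp add: power_mono)
    have Ax: "A *v x = A *v (x - xs)"
      by (simp add: matrix_vector_mult_diff_distrib assms)
    have Av: "A *v v = A *v (v - vs) + A *v vs"
      by (simp add: matrix_vector_mult_diff_distrib)
    have "norm (g + A *v x + A *v v)
        \<le> norm g + norm (A *v x) + norm (A *v (v - vs)) + norm (A *v vs)"
      unfolding Av by (smt (verit) norm_triangle_ineq)
    then have "(norm (g + A *v x + A *v v))\<^sup>2
        \<le> (norm g + norm (A *v x) + norm (A *v (v - vs)) + norm (A *v vs))\<^sup>2"
      by (simp add: power_mono)
    also have "\<dots> \<le> 4 * ((norm g)\<^sup>2 + (norm (A *v x))\<^sup>2 + (norm (A *v (v - vs)))\<^sup>2 + (norm (A *v vs))\<^sup>2)"
      by (rule power2_sum4_le)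
    finally have "(norm (g + A *v x + A *v v))\<^sup>2 + (norm (A *v x))\<^sup>2
        \<le> 4 * G\<^sup>2 + 4 * (norm (A *v vs))\<^sup>2 + 5 * ((norm (x - xs))\<^sup>2 * K\<^sup>2) + 4 * ((norm (v - vs))\<^sup>2 * K\<^sup>2)"
      using g K2[of "x - xs", folded Ax] K2[of "v - vs"] by argo
    also have "\<dots> \<le> c * (1 + ((norm (x - xs))\<^sup>2 + (norm (v - vs))\<^sup>2))"
    proof -
      \<comment> \<open>This is precisely the difference of the two sides once \<open>c\<close> is
        expanded.\<close>
      have "0 \<le> 5 * K\<^sup>2 + (norm (v - vs))\<^sup>2 * K\<^sup>2
          + (4 * G\<^sup>2 + 4 * (norm (A *v vs))\<^sup>2) * ((norm (x - xs))\<^sup>2 + (norm (v - vs))\<^sup>2)"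
        by (intro add_nonneg_nonneg mult_nonneg_nonneg) auto
      then show ?thesis
        by (simp add: c_def algebra_simps)
    qed
    finally show "(norm (g + A *v x + A *v v))\<^sup>2 + (norm (A *v x))\<^sup>2
        \<le> c * (1 + ((norm (x - xs))\<^sup>2 + (norm (v - vs))\<^sup>2))" .
  qed
qed

lemma power2_norm_add_scaleR:
  fixes p q :: "'a::real_inner"
  shows "(norm (p + t *\<^sub>R q))\<^sup>2 = (norm p)\<^sup>2 + 2 * t * (p \<bullet> q) + t\<^sup>2 * (norm q)\<^sup>2"
  unfolding power2_norm_eq_inner
  by (simp add: inner_add_left inner_add_right inner_commute power2_eq_square algebra_simps)

text \<open>Expanding both squares leaves the cross term
  \<open>(x - xs) \<bullet> d - (v - vs) \<bullet> (A *v x)\<close>, taken \<open>- 2 * t\<close>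
  times. Symmetry of \<open>A\<close> cancels \<open>x \<bullet> (A *v v)\<close> against
  \<open>v \<bullet> (A *v x)\<close>, and the subgradient inequalities bound the rest below by the
  gap minus the total error.\<close>

lemma primal_dual_step:
  fixes a :: "real ^ 'n ^ 'n::finite" and x v g x' v' xs vs :: "real ^ 'n"
  defines "A \<equiv> laplacian a"
  assumes "\<And>i. closed (X i)" and "\<And>i. convex (X i)" and xs: "xs \<in> product_set X"
    and wg: "weighted_graph a" and A0: "A *v xs = 0" and t: "0 \<le> t"
    and g: "\<And>i. g $ i \<in> eps_subdifferential e (f i) (x $ i)"
    and x': "\<And>i. x' $ i = closest_point (X i)
          (x $ i - t * (g $ i + disagreement a x i + disagreement a v i))"
    and v': "\<And>i. v' $ i = v $ i + t * disagreement a x i"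
  shows "(norm (x' - xs))\<^sup>2 + (norm (v' - vs))\<^sup>2
    \<le> (norm (x - xs))\<^sup>2 + (norm (v - vs))\<^sup>2
      - 2 * t * (saddle_gap f A xs vs x - real CARD('n) * e)
      + t\<^sup>2 * ((norm (g + A *v x + A *v v))\<^sup>2 + (norm (A *v x))\<^sup>2)"
proof -
  define d where "d = g + A *v x + A *v v"
  have sym: "y \<bullet> (A *v z) = z \<bullet> (A *v y)" for y z
    unfolding A_def by (rule laplacian_inner_commute[OF wg])
  have dn: "d $ i = g $ i + disagreement a x i + disagreement a v i" for i
    by (simp add: d_def A_def laplacian_mult_nth)
  have "norm (x' - xs) \<le> norm ((x - t *\<^sub>R d) - xs)"
    using assms(2,3) xs by (rule norm_projection_diff_le) (simp add: x' dn)
  also have "(x - t *\<^sub>R d) - xs = (x - xs) + (- t) *\<^sub>R d"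
    by simp
  finally have "(norm (x' - xs))\<^sup>2 \<le> (norm ((x - xs) + (- t) *\<^sub>R d))\<^sup>2"
    by (simp add: power_mono)
  then have X: "(norm (x' - xs))\<^sup>2 \<le> (norm (x - xs))\<^sup>2 - 2 * t * ((x - xs) \<bullet> d) + t\<^sup>2 * (norm d)\<^sup>2"
    by (subst (asm) power2_norm_add_scaleR) simp
  have "v' - vs = (v - vs) + t *\<^sub>R (A *v x)"
    by (simp add: vec_eq_iff v' A_def laplacian_mult_nth)
  then have V: "(norm (v' - vs))\<^sup>2
      = (norm (v - vs))\<^sup>2 + 2 * t * ((v - vs) \<bullet> (A *v x)) + t\<^sup>2 * (norm (A *v x))\<^sup>2"
    by (simp only: power2_norm_add_scaleR)
  have "xs \<bullet> (A *v x) = 0" "xs \<bullet> (A *v v) = 0"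
    using sym[of xs] A0 by simp_all
  then have "(x - xs) \<bullet> d - (v - vs) \<bullet> (A *v x)
      = (x - xs) \<bullet> g + x \<bullet> (A *v x) + vs \<bullet> (A *v x)"
    using sym[of x v] by (simp add: d_def inner_add_right inner_diff_left)
  then have "saddle_gap f A xs vs x - real CARD('n) * e \<le> (x - xs) \<bullet> d - (v - vs) \<bullet> (A *v x)"
    using eps_subdifferential_sum[of g e f x xs, OF g] saddle_gap_at_saddle_point[OF A0, of f vs x]
    by linarith
  from mult_left_mono[OF this, of "2 * t"] show ?thesis
    using X V t unfolding d_def[symmetric] by (simp add: algebra_simps)
qed

section \<open>Bounds on the lower limit of the gap\<close>

theorem theorem1:
  fixes f :: "'n::finite \<Rightarrow> real \<Rightarrow> real"
    and X :: "'n \<Rightarrow> real set"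
    and a :: "real ^ 'n ^ 'n"
    and \<alpha> \<epsilon> :: "nat \<Rightarrow> real"
    and \<epsilon>0 C :: real
    and x v g :: "nat \<Rightarrow> real ^ 'n"
    and xs vs :: "real ^ 'n"
  assumes "\<And>i. convex_on UNIV (f i)"
    and "\<And>i. closed (X i)" and "\<And>i. convex (X i)"
    and "(\<Inter>i. interior (X i)) \<noteq> {}"
    and "\<exists>z\<in>(\<Inter>i. X i). \<forall>y\<in>(\<Inter>i. X i). (\<Sum>i\<in>UNIV. f i z) \<le> (\<Sum>i\<in>UNIV. f i y)"
    and "weighted_graph a" and "graph_connected a"
    and "\<And>k. k \<ge> 1 \<Longrightarrow> \<alpha> k > 0"
    and "filterlim (\<lambda>n. \<Sum>k=1..n. \<alpha> k) at_top sequentially"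
    and "summable (\<lambda>k. (\<alpha> (Suc k))\<^sup>2)"
    and "\<epsilon>0 > 0" and "\<And>k. k \<ge> 1 \<Longrightarrow> \<epsilon> k = \<epsilon>0"
    and "\<And>k i. k \<ge> 1 \<Longrightarrow> g k $ i \<in> eps_subdifferential (\<epsilon> k) (f i) (x k $ i)"
    and "\<And>k i. k \<ge> 1 \<Longrightarrow> x (k + 1) $ i =
           closest_point (X i)
             (x k $ i - \<alpha> k * (g k $ i + disagreement a (x k) i + disagreement a (v k) i))"
    and "\<And>k i. k \<ge> 1 \<Longrightarrow> v (k + 1) $ i = v k $ i + \<alpha> k * disagreement a (x k) i"
    and "C > 0" and "\<And>k. k \<ge> 1 \<Longrightarrow> (MAX i. \<bar>g k $ i\<bar>) < C"
    and "saddle_point (aug_lagrangian f (laplacian a)) (product_set X) UNIV xs vs"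
  shows "0 \<le> liminf (\<lambda>k. ereal (saddle_gap f (laplacian a) xs vs (x k))) \<and>
         liminf (\<lambda>k. ereal (saddle_gap f (laplacian a) xs vs (x k))) \<le> ereal (real CARD('n) * \<epsilon>0)"
proof
  note clo = assms(2) and conv = assms(3) and wg = assms(6) and pos = assms(8) and div = assms(9)
    and sq = assms(10) and eps = assms(12) and sub = assms(13) and xstep = assms(14)
    and vstep = assms(15) and gb = assms(17) and sp = assms(18)
  define A where "A = laplacian a"
  define \<Delta> where "\<Delta> = (\<lambda>k. saddle_gap f A xs vs (x k))"
  have ne: "X i \<noteq> {}" for i
    using assms(4) interior_subset[of "X i"] by blast
  have xsX: "xs \<in> product_set X"
    using sp by (simp add: saddle_point_def)
  have A0: "A *v xs = 0"
    using sp unfolding A_def by (rule saddle_point_laplacian_eq_0)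
  \<comment> \<open>The initial point \<open>x 1\<close> may lie outside the product set; projection
    guarantees membership from index 2 on, which suffices for a lower limit.\<close>
  have "x (Suc k) \<in> product_set X" if "1 \<le> k" for k
    using xstep[OF that] closest_point_in_set[OF clo ne] by (simp add: product_set_def)
  then have "0 \<le> \<Delta> (Suc k)" if "1 \<le> k" for k
    unfolding \<Delta>_def A_def using saddle_gap_nonneg[OF wg sp] that by blast
  then have "0 \<le> \<Delta> k" if "2 \<le> k" for k
    using that by (cases k) auto
  then show "0 \<le> liminf (\<lambda>k. ereal (saddle_gap f (laplacian a) xs vs (x k)))"
    unfolding \<Delta>_def A_def
    by (intro Liminf_bounded eventually_sequentiallyI[of 2]) simp
  show "liminf (\<lambda>k. ereal (saddle_gap f (laplacian a) xs vs (x k))) \<le> ereal (real CARD('n) * \<epsilon>0)"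
  proof (rule ccontr)
    assume "\<not> ?thesis"
    then have "ereal (real CARD('n) * \<epsilon>0) < liminf (\<lambda>k. ereal (\<Delta> k))"
      by (simp add: \<Delta>_def A_def)
    \<comment> \<open>An intermediate \<open>r\<close> turns the strict inequality into a fixed
      margin over the error level, valid for all late iterates.\<close>
    then obtain r where r: "real CARD('n) * \<epsilon>0 < r" "ereal r < liminf (\<lambda>k. ereal (\<Delta> k))"
      using ereal_dense2 less_ereal.simps(1) by blast
    from less_LiminfD[OF r(2)] obtain m where m: "\<And>k. m \<le> k \<Longrightarrow> r < \<Delta> k"
      by (auto simp: eventually_sequentially)
    have gn: "norm (g k) \<le> real CARD('n) * C" if "1 \<le> k" for k
    proof -
      have "\<bar>g k $ i\<bar> \<le> C" for i
        using gb[OF that] by (simp add: less_imp_le)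
      then have "(\<Sum>i\<in>UNIV. \<bar>g k $ i\<bar>) \<le> real CARD('n) * C"
        using sum_bounded_above[of UNIV "\<lambda>i. \<bar>g k $ i\<bar>" C] by simp
      then show ?thesis
        using norm_le_l1_cart[of "g k"] by linarith
    qed
    define V where "V = (\<lambda>k. (norm (x k - xs))\<^sup>2 + (norm (v k - vs))\<^sup>2)"
    obtain c where c: "0 \<le> c" "\<And>g x v. norm g \<le> real CARD('n) * C \<Longrightarrow>
        (norm (g + A *v x + A *v v))\<^sup>2 + (norm (A *v x))\<^sup>2
          \<le> c * (1 + ((norm (x - xs))\<^sup>2 + (norm (v - vs))\<^sup>2))"
      using increment_bound[OF A0, of "real CARD('n) * C" vs] by blast
    define \<delta> where "\<delta> = 2 * (r - real CARD('n) * \<epsilon>0)"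
    have \<delta>: "0 < \<delta>"
      using r(1) by (simp add: \<delta>_def)
    \<comment> \<open>Working with \<open>1 + V\<close> absorbs the additive part of the bound
      \<open>c * (1 + V k)\<close>, so the recursion is purely multiplicative. The factor 2 in
      \<open>\<delta>\<close> is the one in front of the gap in
      \<open>primal_dual_step\<close>.\<close>
    have descent: "1 + V (Suc k) \<le> (1 + c * (\<alpha> k)\<^sup>2) * (1 + V k) - \<delta> * \<alpha> k"
      if "1 \<le> k" "m \<le> k" for k
    proof -
      have "V (Suc k) \<le> V k - 2 * \<alpha> k * (\<Delta> k - real CARD('n) * \<epsilon>0)
          + (\<alpha> k)\<^sup>2 * ((norm (g k + A *v x k + A *v v k))\<^sup>2 + (norm (A *v x k))\<^sup>2)"
        unfolding V_def \<Delta>_def A_def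
        using pos[OF that(1)] sub[OF that(1)] xstep[OF that(1)] vstep[OF that(1)] A0
        by (intro primal_dual_step[where X = X] clo conv xsX wg)
           (auto simp: eps[OF that(1)] A_def)
      moreover have "(\<alpha> k)\<^sup>2 * ((norm (g k + A *v x k + A *v v k))\<^sup>2 + (norm (A *v x k))\<^sup>2)
          \<le> (\<alpha> k)\<^sup>2 * (c * (1 + V k))"
        unfolding V_def by (intro mult_left_mono c(2) gn that) simp
      moreover have "\<delta> * \<alpha> k \<le> 2 * \<alpha> k * (\<Delta> k - real CARD('n) * \<epsilon>0)"
        using mult_left_mono[of r "\<Delta> k" "2 * \<alpha> k"] m[OF that(2)] pos[OF that(1)]
        by (simp add: \<delta>_def algebra_simps)
      ultimately show ?thesis
        by (simp add: algebra_simps)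
    qed
    \<comment> \<open>The shift by \<open>Suc m\<close> ensures both that the index is at least 1
      and that the margin over the error level is in force.\<close>
    have sq': "summable (\<lambda>k. (\<alpha> (k + Suc m))\<^sup>2)"
      using summable_ignore_initial_segment[OF sq, of m] by simp
    have "summable (\<lambda>k. \<delta> * \<alpha> (k + Suc m))"
    proof (rule summable_of_perturbed_descent)
      show "1 + V (Suc k + Suc m)
          \<le> (1 + c * (\<alpha> (k + Suc m))\<^sup>2) * (1 + V (k + Suc m)) - \<delta> * \<alpha> (k + Suc m)" for k
        using descent[of "k + Suc m"] by simp
      show "0 \<le> \<delta> * \<alpha> (k + Suc m)" for k
        using \<delta> pos[of "k + Suc m"] by simp
      show "summable (\<lambda>k. c * (\<alpha> (k + Suc m))\<^sup>2)"
        using sq' by (rule summable_mult)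
    qed (use c(1) in \<open>simp_all add: V_def add_nonneg_nonneg\<close>)
    then have "summable (\<lambda>k. \<alpha> (k + Suc m))"
      using \<delta> by simp
    \<comment> \<open>Summability of a tail gives convergence of the full partial sums, against
      their divergence to infinity.\<close>
    then have "summable (\<lambda>k. \<alpha> (Suc k))"
      by (metis summable_Suc_iff summable_iff_shift)
    then have "(\<lambda>n. \<Sum>k<n. \<alpha> (Suc k)) \<longlonglongrightarrow> (\<Sum>k. \<alpha> (Suc k))"
      by (rule summable_LIMSEQ)
    moreover have "(\<Sum>k<n. \<alpha> (Suc k)) = (\<Sum>k=1..n. \<alpha> k)" for n
      by (simp add: sum.atLeast1_atMost_eq)
    ultimately have "(\<lambda>n. \<Sum>k=1..n. \<alpha> k) \<longlonglongrightarrow> (\<Sum>k. \<alpha> (Suc k))"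
      by simp
    then show False
      using not_tendsto_and_filterlim_at_infinity filterlim_at_top_imp_at_infinity[OF div]
        trivial_limit_sequentially by blast
  qed
qed

end
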